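(* Let $m\ge 0$ be an integer and let $P_k,Q_k,P'_k,Q'_k$ ($k\ge 1$) be the integers defined in the context. Then for all integers $k\ge 1$ and $n\ge 1$: (i) with $a=P_k n-\frac{P_k-(2m+1)}{2}$, $$\sqrt{a^2+\left(Q_k n-\frac{Q_k-2}{2}\right)}=\left[a;\ \overline{\underbrace{2m+1,\dots,2m+1}_{3k-2\text{ times}},\ 2a}\right];$$ (ii) with $a'=P'_k n-\frac{P'_k-(2m+1)}{2}$, $$\sqrt{a'^2+\left(Q'_k n-\frac{Q'_k-2}{2}\right)}=\left[a';\ \overline{\underbrace{2m+1,\dots,2m+1}_{3k\text{ times}},\ 2a'}\right].$$
   Context: $[a_0;\overline{a_1,\dots,a_\ell}]$ denotes the value of the infinite simple continued fraction $a_0+\cfrac{1}{a_1+\cfrac{1}{a_2+\dotsb}}$ with first partial quotient $a_0$, after which the block $a_1,\dots,a_\ell$ of positive integers is repeated indefinitely. Write $x=2m+1$ and $M=x(x^2+3)$. The sequences are defined by $$P_1=x,\quad Q_1=2,\quad P_2=x^4+3x^2+1,\quad Q_2=2x^3+4x,$$ $$P'_1=x(x^2+2),\quad Q'_1=2(x^2+1),\quad P'_2=x^6+5x^4+6x^2+1,\quad Q'_2=2(x^5+4x^3+3x),$$ and, for $k\ge 2$, $$P_{k+1}=MP_k+P_{k-1},\quad Q_{k+1}=MQ_k+Q_{k-1},\quad P'_{k+1}=MP'_k+P'_{k-1},\quad Q'_{k+1}=MQ'_k+Q'_{k-1}.$$ *)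

theory Defs
  imports Complex_Main
begin

text \<open>The \<open>n\<close>-th convergent \<open>c 0 + 1 / (c 1 + 1 / (\<dots> + 1 / c n))\<close>.\<close>

fun convergent_of :: "(nat \<Rightarrow> real) \<Rightarrow> nat \<Rightarrow> real" where
  "convergent_of c 0 = c 0"
| "convergent_of c (Suc n) = c 0 + 1 / convergent_of (\<lambda>i. c (Suc i)) n"

text \<open>The partial quotients are real numbers required to be integers, so that quantities given
  by formulas with a division can be used as partial quotients with the exact quotient; their
  integrality is then part of the assertion.\<close>

definition has_simple_cfrac :: "real \<Rightarrow> (nat \<Rightarrow> real) \<Rightarrow> bool" where
  "has_simple_cfrac v c \<longleftrightarrow>
     (\<forall>i. c i \<in> \<int>) \<and> (\<forall>i\<ge>1. c i > 0) \<and> convergent_of c \<longlonglongrightarrow> v"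

definition periodic_cfrac :: "real \<Rightarrow> real list \<Rightarrow> nat \<Rightarrow> real" where
  "periodic_cfrac a0 block i = (if i = 0 then a0 else block ! ((i - 1) mod length block))"

text \<open>\<open>s\<^sub>1 = u\<close>, \<open>s\<^sub>2 = v\<close>, \<open>s\<^sub>k\<^sub>+\<^sub>1 = M s\<^sub>k + s\<^sub>k\<^sub>-\<^sub>1\<close> for \<open>k \<ge> 2\<close>;
  the value at index \<open>0\<close> is a dummy that the recursion never uses.\<close>

fun rec_seq :: "int \<Rightarrow> int \<Rightarrow> int \<Rightarrow> nat \<Rightarrow> int" where
  "rec_seq M u v 0 = 0"
| "rec_seq M u v (Suc 0) = u"
| "rec_seq M u v (Suc (Suc 0)) = v"
| "rec_seq M u v (Suc (Suc (Suc k))) =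
     M * rec_seq M u v (Suc (Suc k)) + rec_seq M u v (Suc k)"

definition seq_P :: "nat \<Rightarrow> nat \<Rightarrow> int" where
  "seq_P m = (let x = 2 * int m + 1
     in rec_seq (x * (x^2 + 3)) x (x^4 + 3 * x^2 + 1))"

definition seq_Q :: "nat \<Rightarrow> nat \<Rightarrow> int" where
  "seq_Q m = (let x = 2 * int m + 1
     in rec_seq (x * (x^2 + 3)) 2 (2 * x^3 + 4 * x))"

definition seq_P' :: "nat \<Rightarrow> nat \<Rightarrow> int" where
  "seq_P' m = (let x = 2 * int m + 1
     in rec_seq (x * (x^2 + 3)) (x * (x^2 + 2)) (x^6 + 5 * x^4 + 6 * x^2 + 1))"

definition seq_Q' :: "nat \<Rightarrow> nat \<Rightarrow> int" where
  "seq_Q' m = (let x = 2 * int m + 1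
     in rec_seq (x * (x^2 + 3)) (2 * (x^2 + 1)) (2 * (x^5 + 4 * x^3 + 3 * x)))"

end

theory Submission
  imports Defs
begin

text \<open>
  Both parts are one statement about the Fibonacci polynomials \<open>F\<close>, where \<open>F 0 = 0\<close>, \<open>F 1 = 1\<close> and
  \<open>F (j + 2) = x * F (j + 1) + F j\<close>.  Since \<open>F (j + 6) = x * (x\<^sup>2 + 3) * F (j + 3) + F j\<close>, the four
  sequences are sections of \<open>F\<close> along arithmetic progressions of difference \<open>3\<close>: if \<open>l\<close> denotes the
  number of partial quotients \<open>x\<close> in the period, then \<open>P = F (l + 1)\<close> and \<open>Q = 2 * F l\<close> in both
  parts (lemmas \<open>seq_fib_poly\<close> and \<open>seq'_fib_poly\<close>).

  Let \<open>s = sqrt (a\<^sup>2 + b)\<close>, so that \<open>(s - a) * (s + a) = b\<close>.  The expansion asserts that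
  \<open>y = 1 / (s - a)\<close> is the value of \<open>x, \<dots>, x\<close> followed by \<open>2 * a + 1 / y = s + a\<close>.  A block of \<open>l\<close>
  copies of \<open>x\<close> acts as the Moebius map with matrix entries \<open>F (l + 1), F l, F l, F (l - 1)\<close>, and the
  fixed point equation becomes the linear condition \<open>b * F (l + 1) = 2 * a * F l + F (l - 1)\<close>.  Its
  integer solutions are parametrised by the given formulas for \<open>a\<close> and \<open>b\<close> in terms of \<open>n\<close>
  (lemma \<open>sqrt_cfrac_fib_poly\<close>).  The quotient \<open>a\<close> is an integer because, for odd \<open>x\<close>, \<open>F j\<close> is even
  only if \<open>3\<close> divides \<open>j\<close>.

  That a fixed point of the block really is the limit of the convergents
  (lemma \<open>periodic_cfrac_converges\<close>) follows from a contraction estimate: two consecutive complete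
  quotients have product at least \<open>2\<close>, so every second step halves the error.
\<close>

section \<open>Convergence of continued fractions\<close>

lemma convergent_of_ge_first:
  assumes "\<And>i. c i \<ge> 1"
  shows "convergent_of c n \<ge> c 0"
  using assms
proof (induction n arbitrary: c)
  case (Suc n)
  have "convergent_of (\<lambda>i. c (Suc i)) n \<ge> c (Suc 0)"
    by (rule Suc.IH) (rule Suc.prems)
  moreover have "c (Suc 0) \<ge> 1"
    by (rule Suc.prems)
  ultimately show ?case
    by simp
qed simp

lemma inverse_diff_bound:
  fixes u v d :: real
  assumes "u > 0" "v > 0" "d > 0" "u * v \<ge> d"
  shows "\<bar>1 / u - 1 / v\<bar> \<le> \<bar>u - v\<bar> / d"
proof -
  have "1 / u - 1 / v = (v - u) / (u * v)"
    using assms by (simp add: field_simps)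
  then have "\<bar>1 / u - 1 / v\<bar> = \<bar>u - v\<bar> / (u * v)"
    using assms by (simp add: abs_minus_commute)
  also have "\<dots> \<le> \<bar>u - v\<bar> / d"
    using assms by (intro divide_left_mono) auto
  finally show ?thesis .
qed

text \<open>The numbers \<open>t i\<close> are the complete quotients of the expansion.  Two steps are taken at once
  because a single complete quotient may be arbitrarily close to \<open>1\<close>, whereas
  \<open>t i * t (i + 1) = c i * t (i + 1) + 1 \<ge> 2\<close>.\<close>

lemma convergent_of_error:
  fixes c t :: "nat \<Rightarrow> real"
  assumes "\<And>i. t i = c i + 1 / t (Suc i)"
    and "\<And>i. c (Suc i) \<ge> 1" and "\<And>i. t (Suc i) > 0"
  shows "\<bar>convergent_of c n - t 0\<bar> \<le> (1 / 2) ^ (n div 2)"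
  using assms
proof (induction n arbitrary: c t rule: less_induct)
  case (less n c t)
  have t_ge: "t (Suc i) \<ge> 1" for i
    using less.prems(1)[of "Suc i"] less.prems(2)[of i] less.prems(3)[of "Suc i"]
    by (simp add: add_increasing2)
  have t0: "t 0 = c 0 + 1 / t 1" and t1: "t 1 = c 1 + 1 / t 2"
    using less.prems(1)[of 0] less.prems(1)[of 1] by (simp_all add: numeral_2_eq_2)
  have c1: "c 1 \<ge> 1"
    using less.prems(2)[of 0] by simp
  have t1_ge: "t 1 \<ge> 1" and t2_ge: "t 2 \<ge> 1"
    using t_ge[of 0] t_ge[of 1] by (simp_all add: numeral_2_eq_2)
  consider "n = 0" | "n = 1" | k where "n = Suc (Suc k)"
    by (metis One_nat_def not0_implies_Suc)
  then show ?case
  proof cases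
    case 1
    then show ?thesis
      using t0 t1_ge by simp
  next
    case 2
    have "0 < 1 / t 1" "1 / t 1 \<le> 1" "0 < 1 / c 1" "1 / c 1 \<le> 1"
      using t1_ge c1 by simp_all
    then have "\<bar>1 / c 1 - 1 / t 1\<bar> \<le> 1"
      by linarith
    then show ?thesis
      using 2 t0 by simp
  next
    case 3
    define C2 where "C2 = convergent_of (\<lambda>i. c (Suc (Suc i))) k"
    define C1 where "C1 = c 1 + 1 / C2"
    have C2_ge: "C2 \<ge> 1"
      using convergent_of_ge_first[of "\<lambda>i. c (Suc (Suc i))" k] less.prems(2)[of 1]
        less.prems(2) unfolding C2_def by (metis order_trans)
    then have C1_ge: "C1 \<ge> 1"
      using c1 by (simp add: C1_def add_increasing2)
    have prod: "t 1 * t 2 \<ge> 2"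
    proof -
      have "t 1 * t 2 = c 1 * t 2 + 1"
        using t2_ge by (subst t1) (simp add: field_simps)
      moreover have "c 1 * t 2 \<ge> 1"
        using c1 t2_ge mult_mono[of 1 "c 1" 1 "t 2"] by simp
      ultimately show ?thesis
        by simp
    qed
    have "convergent_of c n - t 0 = 1 / C1 - 1 / t 1"
      using t0 by (simp add: 3 C1_def C2_def)
    then have "\<bar>convergent_of c n - t 0\<bar> \<le> \<bar>C1 - t 1\<bar> / t 1"
      using inverse_diff_bound[of C1 "t 1" "t 1"] C1_ge t1_ge by simp
    also have "\<bar>C1 - t 1\<bar> = \<bar>1 / C2 - 1 / t 2\<bar>"
      using t1 by (simp add: C1_def)
    also have "\<bar>1 / C2 - 1 / t 2\<bar> / t 1 \<le> \<bar>C2 - t 2\<bar> / t 2 / t 1"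
      using inverse_diff_bound[of C2 "t 2" "t 2"] C2_ge t1_ge t2_ge
      by (intro divide_right_mono) auto
    also have "\<dots> = \<bar>C2 - t 2\<bar> / (t 1 * t 2)"
      by (simp add: mult.commute)
    also have "\<dots> \<le> \<bar>C2 - t 2\<bar> / 2"
      using prod by (intro divide_left_mono) auto
    also have "\<bar>C2 - t 2\<bar> \<le> (1 / 2) ^ (k div 2)"
    proof -
      have "k < n"
        by (simp add: 3)
      from less.IH[of k "\<lambda>i. t (Suc (Suc i))" "\<lambda>i. c (Suc (Suc i))",
          OF this less.prems(1) less.prems(2) less.prems(3)]
      show ?thesis
        by (simp add: C2_def numeral_2_eq_2)
    qed
    finally show ?thesis
      by (simp add: 3)
  qed
qed

lemma convergent_of_tendsto:
  fixes c t :: "nat \<Rightarrow> real"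
  assumes "\<And>i. t i = c i + 1 / t (Suc i)"
    and "\<And>i. c (Suc i) \<ge> 1" and "\<And>i. t (Suc i) > 0"
  shows "convergent_of c \<longlonglongrightarrow> t 0"
proof -
  have "filterlim (\<lambda>n::nat. n div 2) at_top sequentially"
    unfolding filterlim_at_top
  proof
    fix Z :: nat
    show "\<forall>\<^sub>F n in sequentially. Z \<le> n div 2"
      using eventually_ge_at_top[of "2 * Z"] by eventually_elim simp
  qed
  moreover have "(\<lambda>n. (1 / 2 :: real) ^ n) \<longlonglongrightarrow> 0"
    by (rule LIMSEQ_power_zero) simp
  ultimately have "(\<lambda>n. (1 / 2 :: real) ^ (n div 2)) \<longlonglongrightarrow> 0"
    by (rule filterlim_compose[rotated])
  then have "(\<lambda>n. convergent_of c n - t 0) \<longlonglongrightarrow> 0"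
    by (rule tendsto_0_le[where K = 1]) (simp add: convergent_of_error[of t c, OF assms])
  then show ?thesis
    by (simp add: LIM_zero_iff)
qed

section \<open>Periodic continued fractions as fixed points\<close>

fun block_map :: "real list \<Rightarrow> real \<Rightarrow> real" where
  "block_map [] y = y"
| "block_map (b # bs) y = b + 1 / block_map bs y"

lemma block_map_append: "block_map (bs @ cs) y = block_map bs (block_map cs y)"
  by (induction bs) simp_all

lemma block_map_pos:
  assumes "\<And>b. b \<in> set bs \<Longrightarrow> b \<ge> 1" and "y > 0"
  shows "block_map bs y > 0"
  using assms by (induction bs) (fastforce intro!: add_pos_pos)+

text \<open>The complete quotients of a periodic expansion are obtained from the fixed point \<open>y\<close> by
  applying the suffixes of the period; the fixed point equation is what makes the recursion for
  complete quotients hold where one period ends and the next begins.\<close>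

lemma periodic_cfrac_converges:
  assumes ne: "block \<noteq> []" and ge: "\<And>b. b \<in> set block \<Longrightarrow> b \<ge> 1"
    and y: "y > 0" and fix_y: "block_map block y = y"
  shows "convergent_of (periodic_cfrac a0 block) \<longlonglongrightarrow> a0 + 1 / y"
proof -
  define L where "L = length block"
  define q where "q i = block_map (drop (i mod L) block) y" for i
  define t where "t i = (case i of 0 \<Rightarrow> a0 + 1 / y | Suc j \<Rightarrow> q j)" for i
  have L: "L > 0"
    using ne by (simp add: L_def)
  have q0: "q 0 = y"
    by (simp add: q_def fix_y)
  have q_pos: "q i > 0" for i
    unfolding q_def using ge y by (intro block_map_pos) (auto dest: in_set_dropD)
  have q_step: "q i = block ! (i mod L) + 1 / q (Suc i)" for i
  proof -
    have lt: "i mod L < length block"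
      using L by (simp add: L_def)
    have "q i = block ! (i mod L) + 1 / block_map (drop (Suc (i mod L)) block) y"
      unfolding q_def by (subst Cons_nth_drop_Suc[OF lt, symmetric]) simp
    moreover have "block_map (drop (Suc (i mod L)) block) y = q (Suc i)"
    proof (cases "Suc (i mod L) = L")
      case True
      then show ?thesis
        by (simp add: q_def mod_Suc fix_y) (simp add: L_def)
    next
      case False
      then show ?thesis
        by (simp add: q_def mod_Suc)
    qed
    ultimately show ?thesis
      by simp
  qed
  have "t i = periodic_cfrac a0 block i + 1 / t (Suc i)" for i
  proof (cases i)
    case 0
    then show ?thesis
      by (simp add: t_def periodic_cfrac_def q0)
  next
    case (Suc j)
    then show ?thesis
      using q_step[of j] by (simp add: t_def periodic_cfrac_def L_def)
  qed
  moreover have "periodic_cfrac a0 block (Suc i) \<ge> 1" for i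
    using ge ne by (simp add: periodic_cfrac_def)
  moreover have "t (Suc i) > 0" for i
    by (simp add: t_def q_pos)
  ultimately have "convergent_of (periodic_cfrac a0 block) \<longlonglongrightarrow> t 0"
    by (rule convergent_of_tendsto)
  then show ?thesis
    by (simp add: t_def)
qed

section \<open>Fibonacci polynomials\<close>

fun fib_poly :: "int \<Rightarrow> nat \<Rightarrow> int" where
  "fib_poly x 0 = 0"
| "fib_poly x (Suc 0) = 1"
| "fib_poly x (Suc (Suc j)) = x * fib_poly x (Suc j) + fib_poly x j"

lemma fib_poly_nonneg: "x \<ge> 0 \<Longrightarrow> fib_poly x j \<ge> 0"
  by (induction x j rule: fib_poly.induct) simp_all

lemma fib_poly_pos: "x \<ge> 1 \<Longrightarrow> fib_poly x (Suc j) \<ge> 1"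
proof (induction j)
  case (Suc j)
  then have "x * fib_poly x (Suc j) \<ge> 1"
    using mult_mono[of 1 x 1 "fib_poly x (Suc j)"] by simp
  then show ?case
    using fib_poly_nonneg[of x j] Suc.prems by simp
qed simp

text \<open>For odd \<open>x\<close> the recurrence modulo \<open>2\<close> is that of the Fibonacci numbers, which runs through
  \<open>0, 1, 1\<close>.\<close>

lemma even_fib_poly_iff:
  assumes "odd x"
  shows "even (fib_poly x j) \<longleftrightarrow> 3 dvd j"
proof -
  have "even (fib_poly x (3 * i)) \<and> odd (fib_poly x (3 * i + 1)) \<and> odd (fib_poly x (3 * i + 2))" for i
    using assms by (induction i) (simp_all add: numeral_eq_Suc)
  moreover obtain i where "j = 3 * i \<or> j = 3 * i + 1 \<or> j = 3 * i + 2"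
  proof -
    have "\<exists>i. j = 3 * i \<or> j = 3 * i + 1 \<or> j = 3 * i + 2"
      by presburger
    then show thesis
      using that by blast
  qed
  moreover have "\<not> 3 dvd 3 * i + 1" "\<not> 3 dvd 3 * i + 2"
    by presburger+
  ultimately show ?thesis
    by (metis dvd_triv_left)
qed

text \<open>This is the Cayley-Hamilton theorem for the cube of the companion matrix with rows \<open>(x, 1)\<close> and
  \<open>(1, 0)\<close>: the cube has trace \<open>x * (x\<^sup>2 + 3)\<close> and determinant \<open>-1\<close>.\<close>

lemma fib_poly_add_6:
  "fib_poly x (j + 6) = x * (x\<^sup>2 + 3) * fib_poly x (j + 3) + fib_poly x j"
proof -
  have "fib_poly x (Suc (Suc (Suc (Suc (Suc (Suc j))))))
      = x * (x\<^sup>2 + 3) * fib_poly x (Suc (Suc (Suc j))) + fib_poly x j"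
    by (simp add: algebra_simps power2_eq_square)
  then show ?thesis
    by (simp add: numeral_eq_Suc)
qed

lemma rec_seq_fib_poly:
  assumes "u = c * fib_poly x r" and "v = c * fib_poly x (r + 3)"
  shows "rec_seq (x * (x\<^sup>2 + 3)) u v (Suc k) = c * fib_poly x (r + 3 * k)"
proof (induction k rule: less_induct)
  case (less k)
  consider "k = 0" | "k = 1" | j where "k = Suc (Suc j)"
    by (metis One_nat_def not0_implies_Suc)
  then show ?case
  proof cases
    case 3
    have "r + 3 * k = (r + 3 * j) + 6" "r + 3 * Suc j = (r + 3 * j) + 3"
      using 3 by simp_all
    then show ?thesis
      using less.IH[of j] less.IH[of "Suc j"] fib_poly_add_6[of x "r + 3 * j"] 3
      by (simp add: algebra_simps)
  qed (use assms in simp_all)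
qed

lemma seq_fib_poly:
  "seq_P m (Suc k) = fib_poly (2 * int m + 1) (3 * k + 2)"
  "seq_Q m (Suc k) = 2 * fib_poly (2 * int m + 1) (3 * k + 1)"
proof -
  define x where "x = 2 * int m + 1"
  have "seq_P m (Suc k) = 1 * fib_poly x (2 + 3 * k)"
    unfolding seq_P_def Let_def x_def[symmetric]
    by (rule rec_seq_fib_poly) (simp_all add: numeral_eq_Suc algebra_simps)
  then show "seq_P m (Suc k) = fib_poly (2 * int m + 1) (3 * k + 2)"
    by (simp add: x_def add.commute)
  have "seq_Q m (Suc k) = 2 * fib_poly x (1 + 3 * k)"
    unfolding seq_Q_def Let_def x_def[symmetric]
    by (rule rec_seq_fib_poly) (simp_all add: numeral_eq_Suc algebra_simps)
  then show "seq_Q m (Suc k) = 2 * fib_poly (2 * int m + 1) (3 * k + 1)"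
    by (simp add: x_def add.commute)
qed

lemma seq'_fib_poly:
  "seq_P' m (Suc k) = fib_poly (2 * int m + 1) (3 * k + 4)"
  "seq_Q' m (Suc k) = 2 * fib_poly (2 * int m + 1) (3 * k + 3)"
proof -
  define x where "x = 2 * int m + 1"
  have "seq_P' m (Suc k) = 1 * fib_poly x (4 + 3 * k)"
    unfolding seq_P'_def Let_def x_def[symmetric]
    by (rule rec_seq_fib_poly) (simp_all add: numeral_eq_Suc algebra_simps)
  then show "seq_P' m (Suc k) = fib_poly (2 * int m + 1) (3 * k + 4)"
    by (simp add: x_def add.commute)
  have "seq_Q' m (Suc k) = 2 * fib_poly x (3 + 3 * k)"
    unfolding seq_Q'_def Let_def x_def[symmetric]
    by (rule rec_seq_fib_poly) (simp_all add: numeral_eq_Suc algebra_simps)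
  then show "seq_Q' m (Suc k) = 2 * fib_poly (2 * int m + 1) (3 * k + 3)"
    by (simp add: x_def add.commute)
qed

section \<open>Square roots with an almost constant period\<close>

text \<open>The coefficients are the entries of the power with exponent \<open>Suc l\<close> of the matrix with rows
  \<open>(x, 1)\<close> and \<open>(1, 0)\<close>, which represents \<open>z \<mapsto> x + 1 / z\<close>.\<close>

lemma block_map_replicate:
  fixes z :: real
  assumes "x \<ge> 1" and "z > 0"
  shows "block_map (replicate (Suc l) (of_int x)) z =
    (of_int (fib_poly x (Suc (Suc l))) * z + of_int (fib_poly x (Suc l))) /
    (of_int (fib_poly x (Suc l)) * z + of_int (fib_poly x l))"
proof (induction l)
  case 0
  show ?case
    using assms by (simp add: field_simps)
next
  case (Suc l)
  have "of_int (fib_poly x (Suc (Suc l))) \<ge> (1::real)" "of_int (fib_poly x (Suc l)) \<ge> (1::real)"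
    using fib_poly_pos[OF assms(1)] by (simp_all del: fib_poly.simps)
  then have "of_int (fib_poly x (Suc (Suc l))) * z + of_int (fib_poly x (Suc l)) > 0"
    using assms by (intro add_pos_pos mult_pos_pos) linarith+
  then show ?case
    unfolding replicate_Suc[of "Suc l"] block_map.simps Suc.IH
    by (simp add: field_simps)
qed

text \<open>The linear condition on \<open>a\<close> and \<open>b\<close> that makes \<open>1 / (s - a)\<close>, with \<open>s\<close> the square root, a
  fixed point of the block is the fact \<open>key\<close>; the parity hypothesis makes \<open>a\<close> an integer.  The block
  has \<open>Suc l\<close> copies of \<open>x\<close>, which keeps all indices of the Moebius coefficients natural.\<close>

lemma sqrt_cfrac_fib_poly:
  fixes x :: int and l n :: nat and a b :: real
  assumes x: "x \<ge> 1" and n: "n \<ge> 1"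
    and parity: "even (fib_poly x (Suc (Suc l)) - x)"
  defines "P \<equiv> real_of_int (fib_poly x (Suc (Suc l)))"
    and "Q \<equiv> real_of_int (2 * fib_poly x (Suc l))"
  defines "a \<equiv> P * real n - (P - of_int x) / 2"
    and "b \<equiv> Q * real n - (Q - 2) / 2"
  shows "has_simple_cfrac (sqrt (a\<^sup>2 + b))
    (periodic_cfrac a (replicate (Suc l) (of_int x) @ [2 * a]))"
proof -
  define F0 F1 where "F0 = real_of_int (fib_poly x l)" and "F1 = real_of_int (fib_poly x (Suc l))"
  have P_rec: "P = of_int x * F1 + F0"
    by (simp add: P_def F0_def F1_def)
  have F0: "F0 \<ge> 0" and F1: "F1 \<ge> 1" and P: "P \<ge> 1"
    using fib_poly_nonneg[of x l] fib_poly_pos[OF x, of l] fib_poly_pos[OF x, of "Suc l"] x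
    by (simp_all add: F0_def F1_def P_def del: fib_poly.simps)
  have n': "real n \<ge> 1"
    using n by simp
  have x': "real_of_int x \<ge> 1"
    using x by simp
  have "P \<le> P * real n"
    using n' P mult_left_mono[of 1 "real n" P] by simp
  moreover have "2 * a = 2 * (P * real n) - P + of_int x"
    unfolding a_def by (simp add: field_simps)
  ultimately have a_pos: "2 * a \<ge> 1"
    using x' P by linarith
  have b_eq: "b = F1 * (2 * real n - 1) + 1"
    by (simp add: b_def Q_def F1_def field_simps)
  moreover have "F1 * (2 * real n - 1) \<ge> 0"
    using F1 n' by simp
  ultimately have b_pos: "b > 0"
    by linarith
  have key: "b * P = 2 * a * F1 + F0"
    unfolding b_eq a_def by (simp add: P_rec field_simps)

  obtain h where h: "fib_poly x (Suc (Suc l)) - x = 2 * h"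
    using parity by (elim evenE)
  then have "P - of_int x = 2 * of_int h"
    unfolding P_def by (metis of_int_diff of_int_mult of_int_numeral)
  then have "a = P * real n - of_int h"
    by (simp add: a_def)
  then have a_int: "a \<in> \<int>"
    by (simp add: P_def)

  define s where "s = sqrt (a\<^sup>2 + b)"
  have s_gt: "s > a"
    unfolding s_def using b_pos by (intro real_less_rsqrt) simp
  have "s\<^sup>2 = a\<^sup>2 + b"
    using b_pos by (simp add: s_def)
  then have s_b: "(s - a) * (s + a) = b"
    by (simp add: power2_eq_square algebra_simps)
  define y where "y = 1 / (s - a)"
  have y: "y > 0"
    using s_gt by (simp add: y_def)
  have z: "2 * a + 1 / y = s + a"
    by (simp add: y_def)
  have z_pos: "s + a > 0"
    using s_gt a_pos by linarith

  let ?block = "replicate (Suc l) (real_of_int x) @ [2 * a]"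
  have "block_map ?block y = (P * (s + a) + F1) / (F1 * (s + a) + F0)"
    using block_map_replicate[OF x z_pos, of l]
    by (simp only: block_map_append block_map.simps z P_def F0_def F1_def)
  also have "\<dots> = y"
  proof -
    have "(s - a) * (P * (s + a) + F1) = P * ((s - a) * (s + a)) + F1 * (s - a)"
      by (simp add: algebra_simps)
    also have "\<dots> = F1 * (s + a) + F0"
      using key unfolding s_b by (simp add: algebra_simps)
    finally have "(s - a) * (P * (s + a) + F1) = F1 * (s + a) + F0" .
    moreover have "F1 * (s + a) + F0 > 0"
      using F1 F0 mult_pos_pos[OF _ z_pos, of F1] by simp
    ultimately show ?thesis
      using s_gt by (simp add: y_def field_simps)
  qed
  finally have fix_y: "block_map ?block y = y" .
  have ge: "c \<ge> 1" if "c \<in> set ?block" for c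
    using that x' a_pos by (auto split: if_splits)
  have "convergent_of (periodic_cfrac a ?block) \<longlonglongrightarrow> a + 1 / y"
    by (rule periodic_cfrac_converges) (use ge y fix_y in auto)
  moreover have "a + 1 / y = s"
    by (simp add: y_def)
  moreover have quot: "periodic_cfrac a ?block i \<in> set ?block" if "i \<ge> 1" for i
  proof -
    have "(i - 1) mod length ?block < length ?block"
      by simp
    from nth_mem[OF this] show ?thesis
      using that by (simp only: periodic_cfrac_def) simp
  qed
  moreover have "periodic_cfrac a ?block i > 0" if "i \<ge> 1" for i
    using ge[OF quot[OF that]] by linarith
  moreover have "periodic_cfrac a ?block i \<in> \<int>" for i
  proof (cases "i = 0")
    case True
    then show ?thesis
      by (simp add: periodic_cfrac_def a_int)
  next
    case False
    have "set ?block \<subseteq> \<int>"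
      using a_int by (auto split: if_splits)
    then show ?thesis
      using quot[of i] False by auto
  qed
  ultimately show ?thesis
    by (simp add: has_simple_cfrac_def s_def)
qed

theorem mainTheorem5:
  fixes m k n :: nat
  assumes "k \<ge> 1" and "n \<ge> 1"
  shows "(let P = real_of_int (seq_P m k);
              Q = real_of_int (seq_Q m k);
              a = P * real n - (P - (2 * real m + 1)) / 2
          in has_simple_cfrac
               (sqrt (a^2 + (Q * real n - (Q - 2) / 2)))
               (periodic_cfrac a (replicate (3 * k - 2) (2 * real m + 1) @ [2 * a]))) \<and>
         (let P' = real_of_int (seq_P' m k);
              Q' = real_of_int (seq_Q' m k);
              a' = P' * real n - (P' - (2 * real m + 1)) / 2
          in has_simple_cfrac
               (sqrt (a'^2 + (Q' * real n - (Q' - 2) / 2)))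
               (periodic_cfrac a' (replicate (3 * k) (2 * real m + 1) @ [2 * a'])))"
proof -
  obtain j where k: "k = Suc j"
    using assms(1) by (cases k) auto
  define x where "x = 2 * int m + 1"
  have x: "x \<ge> 1" "odd x" and x_real: "2 * real m + 1 = real_of_int x"
    by (simp_all add: x_def)
  have parity: "even (fib_poly x i - x)" if "\<not> 3 dvd i" for i
    using that x(2) by (simp add: even_fib_poly_iff)
  have not_dvd: "\<not> 3 dvd Suc (Suc (3 * j))" "\<not> 3 dvd Suc (Suc (3 * j + 2))"
    by presburger+
  have PQ: "seq_P m k = fib_poly x (Suc (Suc (3 * j)))" "seq_Q m k = 2 * fib_poly x (Suc (3 * j))"
    using seq_fib_poly[of m j] by (simp_all add: k x_def)
  have PQ': "seq_P' m k = fib_poly x (Suc (Suc (3 * j + 2)))"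
    "seq_Q' m k = 2 * fib_poly x (Suc (3 * j + 2))"
    using seq'_fib_poly[of m j] by (simp_all add: k x_def numeral_eq_Suc)
  have len: "3 * k - 2 = Suc (3 * j)" "3 * k = Suc (3 * j + 2)"
    by (simp_all add: k)
  show ?thesis
    unfolding Let_def x_real PQ PQ' len(1) unfolding len(2)
    using sqrt_cfrac_fib_poly[OF x(1) assms(2) parity[OF not_dvd(1)]]
      sqrt_cfrac_fib_poly[OF x(1) assms(2) parity[OF not_dvd(2)]]
    by (rule conjI)
qed

end
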